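(* Let $\lambda>0$, $r>0$, $\tau>0$, $v_{01}>0$, $v_{02}>0$, $h(x)=x_1^2+x_2^2-r^2$, $\|x\|^2=x_1^2+x_2^2$, and consider on $\{(x_1,x_2,w_1,w_2)\in\mathbb R^4: x_1<0,\ x_2<0\}$ the system $$\begin{aligned} \dot x_1&=-\frac{\lambda h}{2\|x\|^2}x_1+\frac{x_2v_{01}-x_1w_2}{\|x\|^2}x_2,\\ \dot x_2&=-\frac{\lambda h}{2\|x\|^2}x_2-\frac{x_2w_1-x_1v_{02}}{\|x\|^2}x_1,\\ \tau\dot w_1&=\frac{x_2}{\|x\|^2}\,(x_2v_{01}+x_1v_{02}-x_2w_1-x_1w_2),\\ \tau\dot w_2&=\frac{x_1}{\|x\|^2}\,(x_2v_{01}+x_1v_{02}-x_2w_1-x_1w_2). \end{aligned}$$ Then: (i) the set of equilibria is exactly the one-dimensional set of points $(x_{1e},x_{2e},w_{1e},w_{2e})$ with $x_{1e},x_{2e}<0$ satisfying $$x_{1e}^2+x_{2e}^2=r^2,\qquad x_{1e}w_{2e}=x_{2e}v_{01},\qquad x_{2e}w_{1e}=x_{1e}v_{02};$$ (ii) at every such equilibrium, with $\mu_e=x_{1e}/x_{2e}$, the Jacobian matrix of the vector field has eigenvalues $$\frac{v_{01}+\mu_e^3v_{02}}{r\mu_e\sqrt{1+\mu_e^2}},\qquad -\lambda,\qquad 0,\qquad -\frac1\tau,$$ the first of which is positive; in particular every equilibrium is (exponentially) unstable.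
   Context: The system is the joint closed-loop dynamics of two agents on perpendicular lines, $\dot x_i=v_i$ ($i=1,2$, $x_i$ the signed distance from the intersection point, $v_{0i}>0$ the constant desired velocity), under the Predictor-Corrector for Collision Avoidance (PCCA) policy when both agents' constraints are active. Agent 1 minimizes $\|v_{11}-v_{01}\|^2+\|v_{12}\|^2$ over $(v_{11},v_{12})$ subject to $\lambda h+2x_1v_{11}+2x_2(v_{12}+w_2)\ge0$, applies the resulting $v_1=v_{11}^*$, and updates $\dot w_2=\frac1\tau(-w_2+v_2-v_{12}^* )$; agent 2 is symmetric (with $w_1$). The claim itself concerns only the displayed differential equation. "Exponentially unstable" means that the linearization has an eigenvalue with positive real part. *)

theory Defs
  imports "HOL-Analysis.Analysis" "HOL-Computational_Algebra.Polynomial"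
begin

section \<open>Eigenvalues of real square matrices\<close>

definition mat_eigenvalue :: "'a::field ^ 'n ^ 'n \<Rightarrow> 'a \<Rightarrow> bool" where
  "mat_eigenvalue A c \<longleftrightarrow> (\<exists>v. v \<noteq> 0 \<and> A *v v = c *s v)"

definition mat_char_poly :: "'a::comm_ring_1 ^ 'n ^ 'n \<Rightarrow> 'a poly" where
  "mat_char_poly A = det (mat [:0, 1:] - map_matrix (\<lambda>a. [:a:]) A)"

text \<open>Eigenvalues of a real matrix are always meant over the complex numbers.\<close>

abbreviation complex_mat :: "real ^ 'n ^ 'm \<Rightarrow> complex ^ 'n ^ 'm" where
  "complex_mat A \<equiv> map_matrix complex_of_real A"

definition spectrum_mset :: "real ^ 'n ^ 'n \<Rightarrow> complex multiset" where
  "spectrum_mset A = proots (mat_char_poly (complex_mat A))"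


section \<open>Equilibria, instability, one-dimensional sets\<close>

definition equilibria :: "('a::zero \<Rightarrow> 'a) \<Rightarrow> 'a set \<Rightarrow> 'a set" where
  "equilibria F S = {p \<in> S. F p = 0}"

definition exponentially_unstable :: "(real ^ 'n \<Rightarrow> real ^ 'n) \<Rightarrow> real ^ 'n \<Rightarrow> bool" where
  "exponentially_unstable F p \<longleftrightarrow>
     F p = 0 \<and> F differentiable (at p) \<and>
     (\<exists>c. mat_eigenvalue (complex_mat (jacobian F (at p))) c \<and> 0 < Re c)"

text \<open>
  A nonempty set that is an embedded one-dimensional \<open>C\<^sup>1\<close> submanifold: near each of its points
  it is the homeomorphic image of an open set of reals under a \<open>C\<^sup>1\<close> immersion.
\<close>

definition one_dimensional :: "'a::real_normed_vector set \<Rightarrow> bool" where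
  "one_dimensional S \<longleftrightarrow> S \<noteq> {} \<and>
     (\<forall>p\<in>S. \<exists>U I \<gamma> \<phi>. open U \<and> p \<in> U \<and> open I \<and>
        homeomorphism I (S \<inter> U) \<gamma> \<phi> \<and> \<gamma> C1_differentiable_on I \<and>
        (\<forall>t\<in>I. vector_derivative \<gamma> (at t) \<noteq> 0))"


section \<open>The closed-loop system\<close>

text \<open>The state is \<open>(x\<^sub>1, x\<^sub>2, w\<^sub>1, w\<^sub>2)\<close>, in this order.\<close>

definition pcca_domain :: "(real ^ 4) set" where
  "pcca_domain = {p. p $ 1 < 0 \<and> p $ 2 < 0}"

definition pcca_field ::
    "real \<Rightarrow> real \<Rightarrow> real \<Rightarrow> real \<Rightarrow> real \<Rightarrow> real ^ 4 \<Rightarrow> real ^ 4" where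
  "pcca_field lam r \<tau> v01 v02 p =
    (let x1 = p $ 1; x2 = p $ 2; w1 = p $ 3; w2 = p $ 4;
         nsq = x1\<^sup>2 + x2\<^sup>2;
         h = x1\<^sup>2 + x2\<^sup>2 - r\<^sup>2
     in vector
      [- (lam * h / (2 * nsq)) * x1 + (x2 * v01 - x1 * w2) / nsq * x2,
       - (lam * h / (2 * nsq)) * x2 - (x2 * w1 - x1 * v02) / nsq * x1,
       (x2 / nsq * (x2 * v01 + x1 * v02 - x2 * w1 - x1 * w2)) / \<tau>,
       (x1 / nsq * (x2 * v01 + x1 * v02 - x2 * w1 - x1 * w2)) / \<tau>])"

end

(*
  Write A = x2 v01 - x1 w2 and B = x2 w1 - x1 v02. The last two equations force A = B; pairing the
  first two with (x1, x2) then gives h = 0, and hence A = B = 0. Since h, A and B all vanish at an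
  equilibrium, the Jacobian there only involves the derivatives of these three functions, and its
  characteristic polynomial factors modulo x1^2 + x2^2 = r^2. The equilibria form a curve,
  parametrized by the ratio x1 / x2 > 0.
*)
theory Submission
  imports Defs
begin

section \<open>Determinants, characteristic polynomials and eigenvalues\<close>

lemma vector_4 [simp]:
  "(vector [x, y, z, w] :: 'a::zero ^ 4) $ 1 = x"
  "(vector [x, y, z, w] :: 'a ^ 4) $ 2 = y"
  "(vector [x, y, z, w] :: 'a ^ 4) $ 3 = z"
  "(vector [x, y, z, w] :: 'a ^ 4) $ 4 = w"
  unfolding vector_def by simp_all

lemma det_4:
  "det (A :: 'a::comm_ring_1 ^ 4 ^ 4) =
     A$1$1 * (A$2$2 * (A$3$3 * A$4$4 - A$3$4 * A$4$3) - A$2$3 * (A$3$2 * A$4$4 - A$3$4 * A$4$2)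
              + A$2$4 * (A$3$2 * A$4$3 - A$3$3 * A$4$2))
   - A$1$2 * (A$2$1 * (A$3$3 * A$4$4 - A$3$4 * A$4$3) - A$2$3 * (A$3$1 * A$4$4 - A$3$4 * A$4$1)
              + A$2$4 * (A$3$1 * A$4$3 - A$3$3 * A$4$1))
   + A$1$3 * (A$2$1 * (A$3$2 * A$4$4 - A$3$4 * A$4$2) - A$2$2 * (A$3$1 * A$4$4 - A$3$4 * A$4$1)
              + A$2$4 * (A$3$1 * A$4$2 - A$3$2 * A$4$1))
   - A$1$4 * (A$2$1 * (A$3$2 * A$4$3 - A$3$3 * A$4$2) - A$2$2 * (A$3$1 * A$4$3 - A$3$3 * A$4$1)
              + A$2$3 * (A$3$1 * A$4$2 - A$3$2 * A$4$1))"
proof -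
  \<comment> \<open>The permutations of {1, 2, 3, 4} are enumerated by peeling off one index at a
    time, down to the singleton {4}.\<close>
  have f1: "finite {2::4, 3, 4}" "1 \<notin> {2::4, 3, 4}"
    and f2: "finite {3::4, 4}" "2 \<notin> {3::4, 4}"
    and f3: "finite {4::4}" "3 \<notin> {4::4}"
    by auto
  show ?thesis
    unfolding det_def UNIV_4
    unfolding sum_over_permutations_insert[OF f1]
    unfolding sum_over_permutations_insert[OF f2]
    unfolding sum_over_permutations_insert[OF f3]
    unfolding permutes_sing
    by (simp add: sign_swap_id permutation_swap_id permutation_compose sign_compose sign_id
        swap_id_eq algebra_simps)
qed

text \<open>Evaluation at \<open>x\<close> is a ring homomorphism, so it commutes with the Leibniz
  sum that defines the determinant.\<close>

lemma poly_mat_char_poly: "poly (mat_char_poly A) x = det (mat x - A)"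
  for A :: "'a::comm_ring_1 ^ 'n ^ 'n"
proof -
  have "poly (of_int (sign p)) x = of_int (sign p)" for p :: "'n \<Rightarrow> 'n"
    by (simp add: sign_def)
  moreover have "poly ((mat [:0, 1:] - map_matrix (\<lambda>a. [:a:]) A) $ i $ j) x = (mat x - A) $ i $ j"
    for i j
    by (simp add: mat_def)
  ultimately show ?thesis
    unfolding mat_char_poly_def det_def by (simp add: poly_sum poly_prod)
qed

text \<open>An eigenvector for \<open>c\<close> is a nonzero kernel vector of
  \<open>mat c - A\<close>, and over a field such a vector exists iff this matrix is
  singular.\<close>

lemma mat_eigenvalue_iff_root: "mat_eigenvalue A c \<longleftrightarrow> poly (mat_char_poly A) c = 0"
  for A :: "'a::field ^ 'n ^ 'n"
proof -
  have "(mat c - A) *v v = c *s v - A *v v" for v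
    by (simp add: vec_eq_iff matrix_vector_mult_def mat_def left_diff_distrib sum_subtractf
        if_distrib[of "\<lambda>x. x * _"] cong: if_cong)
  then have "mat_eigenvalue A c \<longleftrightarrow> \<not> (\<forall>v. (mat c - A) *v v = 0 \<longrightarrow> v = 0)"
    unfolding mat_eigenvalue_def by (metis eq_iff_diff_eq_0)
  then show ?thesis
    by (simp add: poly_mat_char_poly invertible_det_nz invertible_left_inverse
        flip: matrix_left_invertible_ker)
       (metis invertible_det_nz invertible_left_inverse)
qed

section \<open>The matrix of the linearization\<close>

text \<open>
  The Jacobian at an equilibrium \<open>(a, b, a * d, b * c)\<close> with \<open>v\<^sub>0\<^sub>1 = a * c\<close>, \<open>v\<^sub>0\<^sub>2 = b * d\<close>,
  \<open>t = 1 / \<tau>\<close> and \<open>k = 1 / r\<^sup>2\<close>; this substitution makes the entries polynomial, and the entries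
  live in an arbitrary ring so that the same matrix serves over the reals and the complex numbers.
\<close>

definition pcca_jacobian :: "'a \<Rightarrow> 'a \<Rightarrow> 'a \<Rightarrow> 'a \<Rightarrow> 'a \<Rightarrow> 'a \<Rightarrow> 'a \<Rightarrow> 'a::comm_ring_1 ^ 4 ^ 4" where
  "pcca_jacobian l t k a b c d = vector
     [vector [- l * k * a\<^sup>2 - k * b\<^sup>2 * c, k * a * b * (c - l), 0, - k * a * b],
      vector [k * a * b * (d - l), - l * k * b\<^sup>2 - k * a\<^sup>2 * d, - k * a * b, 0],
      vector [t * k * b\<^sup>2 * (d - c), t * k * a * b * (c - d), - t * k * b\<^sup>2, - t * k * a * b],
      vector [t * k * a * b * (d - c), t * k * a\<^sup>2 * (c - d), - t * k * a * b, - t * k * a\<^sup>2]]"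

lemma map_matrix_pcca_jacobian:
  "complex_mat (pcca_jacobian l t k a b c d) =
     pcca_jacobian (of_real l) (of_real t) (of_real k) (of_real a) (of_real b) (of_real c) (of_real d)"
  by (simp add: vec_eq_iff forall_4 pcca_jacobian_def)

text \<open>Rows 3 and 4 of the matrix are \<open>b\<close> and \<open>a\<close> times a common row,
  hence the factor \<open>x\<close>. The parameters \<open>l\<close> and \<open>t\<close> enter the
  other factors multiplied by k (a^2 + b^2), which the assumption normalizes to 1;
  \<open>algebra\<close> verifies the identity modulo this relation.\<close>

lemma det_pcca_jacobian:
  fixes x l t k a b c d :: "'a::field"
  assumes "k * (a\<^sup>2 + b\<^sup>2) = 1"
  shows "det (mat x - pcca_jacobian l t k a b c d) =
           (x + k * (b\<^sup>2 * c + a\<^sup>2 * d)) * (x + l) * x * (x + t)"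
  unfolding det_4 using assms by (simp add: mat_def pcca_jacobian_def) algebra

section \<open>Differentiating the vector field at an equilibrium\<close>

lemma has_derivative_vec_componentwise:
  fixes f :: "'a::real_normed_vector \<Rightarrow> real ^ 'n"
  assumes "\<And>i. ((\<lambda>x. f x $ i) has_derivative (\<lambda>y. f' y $ i)) (at x within S)"
  shows "(f has_derivative f') (at x within S)"
  using assms
  by (subst has_derivative_componentwise_within) (auto simp: Basis_vec_def inner_axis)

lemma has_vector_derivative_vec_componentwise:
  fixes f :: "real \<Rightarrow> real ^ 'n"
  assumes "\<And>i. ((\<lambda>t. f t $ i) has_real_derivative f' $ i) (at t within S)"
  shows "(f has_vector_derivative f') (at t within S)"
  using assms unfolding has_vector_derivative_def
  by (intro has_derivative_vec_componentwise)
     (simp add: has_field_derivative_def mult_commute_abs)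

text \<open>In the product rule the derivative of \<open>f\<close> is multiplied by
  \<open>g x = 0\<close>, so it never has to be computed.\<close>

lemma has_derivative_mult_zero:
  fixes f g :: "'a::real_normed_vector \<Rightarrow> real"
  assumes "f differentiable (at x)" "(g has_derivative g') (at x)" "g x = 0"
  shows "((\<lambda>x. f x * g x) has_derivative (\<lambda>y. f x * g' y)) (at x)"
proof -
  obtain f' where "(f has_derivative f') (at x)"
    using assms(1) by (auto simp: differentiable_def)
  from has_derivative_mult[OF this assms(2)] show ?thesis
    by (simp add: assms(3))
qed

lemma differentiable_vec_nth: "(\<lambda>x :: real ^ 'n. x $ i) differentiable F"
  by (intro bounded_linear_imp_differentiable bounded_linear_vec_nth)

text \<open>The assumptions on \<open>c\<close> and \<open>d\<close> are the equilibrium equations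
  in ratio form: \<open>c\<close> is the common value of v01 / x1 and w2 / x2, and \<open>d\<close>
  that of v02 / x2 and w1 / x1.\<close>

lemma pcca_field_has_derivative:
  assumes neg: "p $ 1 < 0" "p $ 2 < 0" and \<tau>: "\<tau> > 0"
    and circle: "(p $ 1)\<^sup>2 + (p $ 2)\<^sup>2 = r\<^sup>2"
    and v01: "v01 = p $ 1 * c" "p $ 4 = p $ 2 * c"
    and v02: "v02 = p $ 2 * d" "p $ 3 = p $ 1 * d"
  shows "(pcca_field lam r \<tau> v01 v02 has_derivative
           (*v) (pcca_jacobian lam (1 / \<tau>) (1 / r\<^sup>2) (p $ 1) (p $ 2) c d)) (at p)"
proof -
  define N where "N p = (p $ 1)\<^sup>2 + (p $ 2)\<^sup>2" for p :: "real ^ 4"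
  define h where "h p = N p - r\<^sup>2" for p
  define A where "A p = p $ 2 * v01 - p $ 1 * p $ 4" for p :: "real ^ 4"
  define B where "B p = p $ 2 * p $ 3 - p $ 1 * v02" for p :: "real ^ 4"
  have Np: "N p > 0" using neg by (simp add: N_def add_pos_pos)
  note nth = bounded_linear.has_derivative[OF bounded_linear_vec_nth has_derivative_ident]
  have h': "(h has_derivative (\<lambda>y. 2 * p $ 1 * y $ 1 + 2 * p $ 2 * y $ 2)) (at p)"
    unfolding h_def N_def
    by (rule derivative_eq_intros nth refl | simp add: algebra_simps)+
  have A': "(A has_derivative (\<lambda>y. v01 * y $ 2 - p $ 4 * y $ 1 - p $ 1 * y $ 4)) (at p)"
    unfolding A_def
    by (rule derivative_eq_intros nth refl | simp add: algebra_simps)+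
  have B': "(B has_derivative (\<lambda>y. p $ 3 * y $ 2 + p $ 2 * y $ 3 - v02 * y $ 1)) (at p)"
    unfolding B_def
    by (rule derivative_eq_intros nth refl | simp add: algebra_simps)+
  have zero: "h p = 0" "A p = 0" "B p = 0" "A p - B p = 0"
    using circle by (simp_all add: h_def N_def A_def B_def v01 v02)
  have dN: "N differentiable (at p)" "N p \<noteq> 0"
    using Np unfolding N_def by (auto intro!: differentiable_add differentiable_power differentiable_vec_nth)
  note diffs = differentiable_minus differentiable_divide differentiable_mult
    differentiable_vec_nth differentiable_const dN(1)
  \<comment> \<open>Each summand is a coefficient times a function vanishing at \<open>p\<close>, so the coefficients need not be
     differentiated explicitly.\<close>
  have F: "pcca_field lam r \<tau> v01 v02 = (\<lambda>p. vector
      [- (lam * p $ 1 / (2 * N p)) * h p + p $ 2 / N p * A p,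
       - (lam * p $ 2 / (2 * N p)) * h p + - (p $ 1 / N p) * B p,
       p $ 2 / N p / \<tau> * (A p - B p),
       p $ 1 / N p / \<tau> * (A p - B p)])"
  proof
    fix q :: "real ^ 4"
    have E: "q $ 2 * v01 + q $ 1 * v02 - q $ 2 * q $ 3 - q $ 1 * q $ 4 = A q - B q"
      by (simp add: A_def B_def)
    show "pcca_field lam r \<tau> v01 v02 q = vector
      [- (lam * q $ 1 / (2 * N q)) * h q + q $ 2 / N q * A q,
       - (lam * q $ 2 / (2 * N q)) * h q + - (q $ 1 / N q) * B q,
       q $ 2 / N q / \<tau> * (A q - B q),
       q $ 1 / N q / \<tau> * (A q - B q)]"
      unfolding pcca_field_def Let_def E N_def[symmetric] h_def[symmetric] A_def[symmetric]
        B_def[symmetric]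
      by (simp add: vec_eq_iff forall_4 mult_ac)
  qed
  \<comment> \<open>Naming the three differentials keeps them atomic in the derivative rules
    below.\<close>
  define dh dA dB where "dh y = 2 * p $ 1 * y $ 1 + 2 * p $ 2 * y $ 2"
    and "dA y = v01 * y $ 2 - p $ 4 * y $ 1 - p $ 1 * y $ 4"
    and "dB y = p $ 3 * y $ 2 + p $ 2 * y $ 3 - v02 * y $ 1" for y :: "real ^ 4"
  note h' = h'[folded dh_def] and A' = A'[folded dA_def] and B' = B'[folded dB_def]
  have "((\<lambda>p. - (lam * p $ 1 / (2 * N p)) * h p + p $ 2 / N p * A p) has_derivative
     (\<lambda>y. - (lam * p $ 1 / (2 * N p)) * dh y + p $ 2 / N p * dA y)) (at p)"
    by (intro has_derivative_add has_derivative_mult_zero h' A' zero diffs) (use dN in auto)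
  moreover have "((\<lambda>p. - (lam * p $ 2 / (2 * N p)) * h p + - (p $ 1 / N p) * B p) has_derivative
     (\<lambda>y. - (lam * p $ 2 / (2 * N p)) * dh y + - (p $ 1 / N p) * dB y)) (at p)"
    by (intro has_derivative_add has_derivative_mult_zero h' B' zero diffs) (use dN in auto)
  moreover have "((\<lambda>p. p $ j / N p / \<tau> * (A p - B p)) has_derivative
     (\<lambda>y. p $ j / N p / \<tau> * (dA y - dB y))) (at p)" for j
    by (intro has_derivative_diff has_derivative_mult_zero A' B' zero diffs) (use dN \<tau> in auto)
  moreover have "pcca_jacobian lam (1 / \<tau>) (1 / r\<^sup>2) (p $ 1) (p $ 2) c d *v y = vector
      [- (lam * p $ 1 / (2 * N p)) * dh y + p $ 2 / N p * dA y,
       - (lam * p $ 2 / (2 * N p)) * dh y + - (p $ 1 / N p) * dB y,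
       p $ 2 / N p / \<tau> * (dA y - dB y),
       p $ 1 / N p / \<tau> * (dA y - dB y)]" for y
  proof -
    \<comment> \<open>On the circle the denominator of the field is r^2, which matches the argument
      \<open>1 / r\<^sup>2\<close> of the matrix.\<close>
    have "N p = r\<^sup>2" "r \<noteq> 0" using circle Np by (auto simp: N_def)
    then show ?thesis
      using \<tau> by (simp add: vec_eq_iff forall_4 matrix_vector_mult_def sum_4 pcca_jacobian_def
          dh_def dA_def dB_def v01 v02) (simp add: field_simps power2_eq_square)
  qed
  ultimately have "((\<lambda>x. pcca_field lam r \<tau> v01 v02 x $ i) has_derivative
      (\<lambda>y. (pcca_jacobian lam (1 / \<tau>) (1 / r\<^sup>2) (p $ 1) (p $ 2) c d *v y) $ i)) (at p)" for i
    using exhaust_4[of i] unfolding F by (elim disjE) (simp_all only: vector_4)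
  then show ?thesis
    by (rule has_derivative_vec_componentwise)
qed

section \<open>Spectrum of the linearization\<close>

lemma proots_linear_factors_4:
  fixes a b c d :: "'a::idom"
  shows "proots ([:- a, 1:] * [:- b, 1:] * [:- c, 1:] * [:- d, 1:]) = {#a, b, c, d#}"
  by (subst proots_mult, simp, simp)+ simp

text \<open>Both forms follow from one factorization: the multiset records algebraic multiplicities,
  the set refers to actual eigenvectors.\<close>

lemma pcca_jacobian_spectrum:
  fixes l t k a b c d :: real
  assumes k: "k * (a\<^sup>2 + b\<^sup>2) = 1"
  defines "J \<equiv> complex_mat (pcca_jacobian l t k a b c d)"
  shows "proots (mat_char_poly J) =
           {#complex_of_real (- k * (b\<^sup>2 * c + a\<^sup>2 * d)), complex_of_real (- l), 0, complex_of_real (- t)#}"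
    and "{z. mat_eigenvalue J z} =
           {complex_of_real (- k * (b\<^sup>2 * c + a\<^sup>2 * d)), complex_of_real (- l), 0, complex_of_real (- t)}"
proof -
  let ?s = "complex_of_real (- k * (b\<^sup>2 * c + a\<^sup>2 * d))"
  have k': "complex_of_real k * ((complex_of_real a)\<^sup>2 + (complex_of_real b)\<^sup>2) = 1"
    using arg_cong[OF k, of complex_of_real] by simp
  have *: "poly (mat_char_poly J) x = (x - ?s) * (x - complex_of_real (- l)) * (x - 0) * (x - complex_of_real (- t))" for x
    unfolding J_def map_matrix_pcca_jacobian poly_mat_char_poly det_pcca_jacobian[OF k'] by simp
  \<comment> \<open>The factorization is known pointwise; over the infinite field of complex
    numbers, equal values at all points give equal polynomials.\<close>
  then have "mat_char_poly J = [:- ?s, 1:] * [:- complex_of_real (- l), 1:] * [:- 0, 1:] * [:- complex_of_real (- t), 1:]"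
    by (subst poly_eq_poly_eq_iff[symmetric]) (simp add: fun_eq_iff algebra_simps)
  then show "proots (mat_char_poly J) = {#?s, complex_of_real (- l), 0, complex_of_real (- t)#}"
    by (simp only: proots_linear_factors_4)
  show "{z. mat_eigenvalue J z} = {?s, complex_of_real (- l), 0, complex_of_real (- t)}"
    unfolding mat_eigenvalue_iff_root * by (auto simp: eq_neg_iff_add_eq_0)
qed

section \<open>The equilibrium set\<close>

lemma equilibria_pcca_field:
  assumes "lam > 0" "r > 0" "\<tau> > 0"
  shows "equilibria (pcca_field lam r \<tau> v01 v02) pcca_domain =
           {p. p $ 1 < 0 \<and> p $ 2 < 0 \<and> (p $ 1)\<^sup>2 + (p $ 2)\<^sup>2 = r\<^sup>2 \<and>
               p $ 1 * p $ 4 = p $ 2 * v01 \<and> p $ 2 * p $ 3 = p $ 1 * v02}"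
proof -
  have "pcca_field lam r \<tau> v01 v02 p = 0 \<longleftrightarrow>
      (p $ 1)\<^sup>2 + (p $ 2)\<^sup>2 = r\<^sup>2 \<and> p $ 1 * p $ 4 = p $ 2 * v01 \<and> p $ 2 * p $ 3 = p $ 1 * v02"
    (is "?F = 0 \<longleftrightarrow> ?R") if neg: "p $ 1 < 0" "p $ 2 < 0" for p
  proof
    define x y N A B where "x = p $ 1" "y = p $ 2" "N = x\<^sup>2 + y\<^sup>2"
      and "A = y * v01 - x * p $ 4" "B = y * p $ 3 - x * v02"
    note defs = this
    \<comment> \<open>\<open>K\<close> is the radial coefficient of the first two equations. Since
      \<open>lam\<close> and \<open>N\<close> are positive, it vanishes exactly on the
      circle.\<close>
    define K where "K = lam * (N - r\<^sup>2) / (2 * N)"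
    have N: "N > 0" using neg by (simp add: defs add_pos_pos)
    assume "?F = 0"
    then have "?F $ i = 0" for i by simp
    from this[of 1] this[of 2] this[of 3]
    have 1: "- K * x + A / N * y = 0" and 2: "- K * y - B / N * x = 0"
      and 3: "y / N * (y * v01 + x * v02 - y * p $ 3 - x * p $ 4) / \<tau> = 0"
      by (simp_all add: pcca_field_def Let_def K_def defs)
    from 3 have AB: "B = A" using N neg assms by (simp add: defs)
    define P where "P = A / N"
    have "K * x = P * y" "K * y = - P * x"
      using 1 2 by (simp_all add: AB P_def)
    \<comment> \<open>Adding \<open>x\<close> times the first equation to \<open>y\<close> times the
      second cancels the tangential terms P x y and leaves K (x^2 + y^2).\<close>
    then have "K * N = 0" unfolding defs(3) by algebra
    then have K0: "K = 0" using N by simp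
    then have "N = r\<^sup>2" using N assms by (simp add: K_def)
    moreover have "A = 0" using 1 K0 N neg by (simp add: defs(2))
    ultimately show ?R using AB by (simp add: defs)
  next
    assume ?R
    then show "?F = 0"
      by (simp add: pcca_field_def Let_def vec_eq_iff forall_4)
  qed
  then show ?thesis
    unfolding equilibria_def pcca_domain_def by auto
qed

section \<open>The equilibria as a curve\<close>

text \<open>A single global chart serves at every point, with the whole space as the
  neighbourhood.\<close>

lemma one_dimensional_if_parametrized:
  assumes "open I" "I \<noteq> {}" "homeomorphism I S \<gamma> \<phi>"
    and "\<And>t. t \<in> I \<Longrightarrow> (\<gamma> has_vector_derivative \<gamma>' t) (at t)" "continuous_on I \<gamma>'"
    and "\<And>t. t \<in> I \<Longrightarrow> \<gamma>' t \<noteq> 0"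
  shows "one_dimensional S"
proof -
  have "S \<noteq> {}" using assms(2,3) by (auto simp: homeomorphism_def)
  moreover have "\<gamma> C1_differentiable_on I" using assms(4,5) by (auto simp: C1_differentiable_on_def)
  moreover have "vector_derivative \<gamma> (at t) \<noteq> 0" if "t \<in> I" for t
    using assms(4,6) that by (metis vector_derivative_at)
  ultimately show ?thesis
    unfolding one_dimensional_def using assms(1,3)
    by (metis Int_UNIV_right UNIV_I open_UNIV)
qed

lemma one_dimensional_equilibria:
  assumes pos: "r > 0" "v01 > 0" "v02 > 0"
  shows "one_dimensional {p :: real ^ 4. p $ 1 < 0 \<and> p $ 2 < 0 \<and> (p $ 1)\<^sup>2 + (p $ 2)\<^sup>2 = r\<^sup>2 \<and>
               p $ 1 * p $ 4 = p $ 2 * v01 \<and> p $ 2 * p $ 3 = p $ 1 * v02}" (is "one_dimensional ?S")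
proof -
  \<comment> \<open>Setting x1 = m x2, the circle equation with the negative root gives x2 = - r /
    sqrt (1 + m^2); the other two equations then give w1 = m v02 and w2 = v01 / m.\<close>
  define \<gamma> :: "real \<Rightarrow> real ^ 4" where
    "\<gamma> m = vector [- (r * m / sqrt (1 + m\<^sup>2)), - (r / sqrt (1 + m\<^sup>2)), m * v02, v01 / m]" for m
  define \<gamma>' :: "real \<Rightarrow> real ^ 4" where
    "\<gamma>' m = vector [- (r / sqrt (1 + m\<^sup>2) ^ 3), r * m / sqrt (1 + m\<^sup>2) ^ 3, v02, - (v01 / m\<^sup>2)]" for m
  \<comment> \<open>The parameter is read off from w1 = m v02, which makes the inverse linear on the
    whole space; on the curve it agrees with x1 / x2.\<close>
  define \<phi> :: "real ^ 4 \<Rightarrow> real" where "\<phi> p = p $ 3 / v02" for p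
  have s: "sqrt (1 + m\<^sup>2) > 0" "sqrt (1 + m\<^sup>2) * sqrt (1 + m\<^sup>2) = 1 + m\<^sup>2" "1 + m\<^sup>2 > 0" for m :: real
    by (simp_all add: add_pos_nonneg)
  have s0: "sqrt (1 + m\<^sup>2) \<noteq> 0" "1 + m\<^sup>2 \<noteq> 0" for m :: real using s[of m] by auto
  have deriv: "(\<gamma> has_vector_derivative \<gamma>' m) (at m)" if "m > 0" for m
  proof (rule has_vector_derivative_vec_componentwise)
    fix i :: 4
    have ds: "((\<lambda>m. sqrt (1 + m\<^sup>2)) has_real_derivative m / sqrt (1 + m\<^sup>2)) (at m)"
      using s[of m] by (auto intro!: derivative_eq_intros simp: field_simps)
    have "((\<lambda>m. - (r * m / sqrt (1 + m\<^sup>2))) has_real_derivative - (r / sqrt (1 + m\<^sup>2) ^ 3)) (at m)"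
      by (rule derivative_eq_intros ds refl s0)+
         (use s[of m] s0[of m] in \<open>simp add: field_simps power2_eq_square power3_eq_cube\<close>)
    moreover have "((\<lambda>m. - (r / sqrt (1 + m\<^sup>2))) has_real_derivative r * m / sqrt (1 + m\<^sup>2) ^ 3) (at m)"
      by (rule derivative_eq_intros ds refl s0)+
         (use s0[of m] in \<open>simp add: field_simps power3_eq_cube\<close>)
    moreover have "((\<lambda>m. m * v02) has_real_derivative v02) (at m)"
      by (auto intro!: derivative_eq_intros)
    moreover have "((\<lambda>m. v01 / m) has_real_derivative - (v01 / m\<^sup>2)) (at m)"
      using that by (auto intro!: derivative_eq_intros simp: power2_eq_square)
    ultimately show "((\<lambda>m. \<gamma> m $ i) has_real_derivative \<gamma>' m $ i) (at m)"
      using exhaust_4[of i] by (elim disjE) (simp_all add: \<gamma>_def \<gamma>'_def)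
  qed
  have "homeomorphism {0<..} ?S \<gamma> \<phi>"
  proof (rule homeomorphismI)
    show "continuous_on {0<..} \<gamma>"
      using deriv by (intro continuous_at_imp_continuous_on) (auto intro: has_vector_derivative_continuous)
    show "continuous_on ?S \<phi>"
      unfolding \<phi>_def by (intro continuous_intros) (use pos in auto)
    have "(- (r * m / sqrt (1 + m\<^sup>2)))\<^sup>2 + (- (r / sqrt (1 + m\<^sup>2)))\<^sup>2 = (r\<^sup>2 * (1 + m\<^sup>2)) / (1 + m\<^sup>2)" for m
      using s(3)[of m] by (simp add: power_divide power_mult_distrib add_divide_distrib distrib_left)
    then have "(- (r * m / sqrt (1 + m\<^sup>2)))\<^sup>2 + (- (r / sqrt (1 + m\<^sup>2)))\<^sup>2 = r\<^sup>2" for m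
      using s0(2)[of m] by simp
    then show "\<gamma> ` {0<..} \<subseteq> ?S"
      using s pos s0 by (auto simp: \<gamma>_def)
    show "\<phi> ` ?S \<subseteq> {0<..}"
    proof
      fix m
      assume "m \<in> \<phi> ` ?S"
      then obtain p :: "real ^ 4" where "p $ 1 < 0" "p $ 2 < 0" "p $ 2 * p $ 3 = p $ 1 * v02" "m = \<phi> p"
        by auto
      then have "\<phi> p = p $ 1 / p $ 2"
        using pos by (simp add: \<phi>_def frac_eq_eq mult.commute)
      with \<open>m = \<phi> p\<close> have "m = p $ 1 / p $ 2"
        by simp
      with \<open>p $ 1 < 0\<close> \<open>p $ 2 < 0\<close> show "m \<in> {0<..}"
        by (simp add: zero_less_divide_iff)
    qed
    show "\<phi> (\<gamma> m) = m" if "m \<in> {0<..}" for m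
      using pos by (simp add: \<phi>_def \<gamma>_def)
    show "\<gamma> (\<phi> p) = p" if "p \<in> ?S" for p
    proof -
      define m where "m = p $ 1 / p $ 2"
      from that have p: "p $ 1 < 0" "p $ 2 < 0" "(p $ 1)\<^sup>2 + (p $ 2)\<^sup>2 = r\<^sup>2"
        "p $ 1 * p $ 4 = p $ 2 * v01" "p $ 2 * p $ 3 = p $ 1 * v02" by auto
      have m: "\<phi> p = m" "p $ 1 = m * p $ 2" "m > 0"
        using p pos by (simp_all add: \<phi>_def m_def field_simps zero_less_divide_iff)
      \<comment> \<open>This is the circle equation divided by x2^2. As x2 < 0, the nonnegative
        square root is r / (- x2).\<close>
      have "1 + m\<^sup>2 = (r / - p $ 2)\<^sup>2"
        using p by (simp add: m_def field_simps power_divide)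
      then have "sqrt (1 + m\<^sup>2) = r / - p $ 2"
        using p pos by (simp add: real_sqrt_unique)
      then show ?thesis
        using p pos m by (simp add: \<gamma>_def vec_eq_iff forall_4) (simp add: field_simps)
    qed
  qed
  moreover have "continuous_on {0<..} \<gamma>'"
  proof -
    have "continuous_on {0<..} (\<lambda>m. \<gamma>' m $ i)" for i
      using exhaust_4[of i] by (elim disjE) (auto simp: \<gamma>'_def s0 intro!: continuous_intros)
    then have "continuous_on {0<..} (\<lambda>m. \<chi> i. \<gamma>' m $ i)"
      by (intro continuous_on_vec_lambda)
    then show ?thesis by simp
  qed
  \<comment> \<open>The third component is the constant \<open>v02\<close>, which is
    positive.\<close>
  moreover have "\<gamma>' m \<noteq> 0" for m
    using pos by (auto simp: \<gamma>'_def vec_eq_iff forall_4)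
  ultimately show ?thesis
    using deriv by (intro one_dimensional_if_parametrized[of "{0<..}" _ \<gamma> \<phi> \<gamma>']) auto
qed

section \<open>Eigenvalues in terms of the ratio, and instability\<close>

theorem mainTheorem5:
  fixes lam r \<tau> v01 v02 :: real
  assumes "lam > 0" and "r > 0" and "\<tau> > 0" and "v01 > 0" and "v02 > 0"
  defines "F \<equiv> pcca_field lam r \<tau> v01 v02"
  shows "equilibria F pcca_domain =
           {p. p $ 1 < 0 \<and> p $ 2 < 0 \<and> (p $ 1)\<^sup>2 + (p $ 2)\<^sup>2 = r\<^sup>2 \<and>
               p $ 1 * p $ 4 = p $ 2 * v01 \<and> p $ 2 * p $ 3 = p $ 1 * v02}
         \<and> one_dimensional (equilibria F pcca_domain)
         \<and> (\<forall>p \<in> equilibria F pcca_domain.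
              let \<mu> = p $ 1 / p $ 2;
                  \<sigma> = (v01 + \<mu> ^ 3 * v02) / (r * \<mu> * sqrt (1 + \<mu>\<^sup>2));
                  J = jacobian F (at p)
              in F differentiable (at p)
                 \<and> spectrum_mset J =
                     {# complex_of_real \<sigma>, complex_of_real (- lam), 0, complex_of_real (- 1 / \<tau>) #}
                 \<and> {c. mat_eigenvalue (complex_mat J) c} =
                     {complex_of_real \<sigma>, complex_of_real (- lam), 0, complex_of_real (- 1 / \<tau>)}
                 \<and> \<sigma> > 0
                 \<and> exponentially_unstable F p)"
proof -
  note equilibria = equilibria_pcca_field[OF assms(1-3), of v01 v02, folded F_def]
  have "F differentiable (at p)
      \<and> spectrum_mset (jacobian F (at p)) =
          {# complex_of_real \<sigma>, complex_of_real (- lam), 0, complex_of_real (- 1 / \<tau>) #}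
      \<and> {c. mat_eigenvalue (complex_mat (jacobian F (at p))) c} =
          {complex_of_real \<sigma>, complex_of_real (- lam), 0, complex_of_real (- 1 / \<tau>)}
      \<and> \<sigma> > 0 \<and> exponentially_unstable F p"
    if "p \<in> equilibria F pcca_domain" and \<mu>_def: "\<mu> = p $ 1 / p $ 2"
      and \<sigma>_def: "\<sigma> = (v01 + \<mu> ^ 3 * v02) / (r * \<mu> * sqrt (1 + \<mu>\<^sup>2))" for p \<mu> \<sigma>
  proof -
    from that(1) have p: "p $ 1 < 0" "p $ 2 < 0" "(p $ 1)\<^sup>2 + (p $ 2)\<^sup>2 = r\<^sup>2"
      "p $ 1 * p $ 4 = p $ 2 * v01" "p $ 2 * p $ 3 = p $ 1 * v02"
      unfolding equilibria by auto
    \<comment> \<open>With these ratios the remaining equilibrium equations read w2 = x2 c and w1 =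
      x1 d, as the derivative lemma expects.\<close>
    define c d where "c = v01 / p $ 1" and "d = v02 / p $ 2"
    define J where "J = pcca_jacobian lam (1 / \<tau>) (1 / r\<^sup>2) (p $ 1) (p $ 2) c d"
    have "(F has_derivative (*v) J) (at p)"
      unfolding F_def J_def
      by (rule pcca_field_has_derivative) (use p assms in \<open>auto simp: c_def d_def field_simps\<close>)
    \<comment> \<open>Uniqueness of the Frechet derivative identifies the Jacobian with
      \<open>J\<close>.\<close>
    then have diff: "F differentiable (at p)" and J: "jacobian F (at p) = J"
      by (auto simp: differentiable_def jacobian_def simp flip: frechet_derivative_at)
    have \<mu>: "\<mu> > 0" using p by (simp add: \<mu>_def zero_less_divide_iff)
    have \<sigma>: "\<sigma> > 0" unfolding \<sigma>_def
      using \<mu> assms by (intro divide_pos_pos mult_pos_pos add_pos_pos) (auto simp: add_pos_nonneg)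
    have "1 + \<mu>\<^sup>2 = (r / - p $ 2)\<^sup>2"
      using p by (simp add: \<mu>_def field_simps power_divide)
    then have "sqrt (1 + \<mu>\<^sup>2) = r / - p $ 2"
      using p assms by (simp add: real_sqrt_unique)
    \<comment> \<open>The square root just found turns the denominator of \<open>\<sigma>\<close>
      into r \<mu> sqrt (1 + \<mu>^2) = - r^2 x1 / x2^2, and the two expressions agree after
      clearing fractions.\<close>
    then have \<sigma>_eq: "- (1 / r\<^sup>2) * ((p $ 2)\<^sup>2 * c + (p $ 1)\<^sup>2 * d) = \<sigma>"
      using p assms \<mu> unfolding \<sigma>_def c_def d_def
      by (simp add: \<mu>_def field_simps power2_eq_square power3_eq_cube)
    have k: "1 / r\<^sup>2 * ((p $ 1)\<^sup>2 + (p $ 2)\<^sup>2) = 1"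
      using p assms by simp
    note spec = pcca_jacobian_spectrum[OF k, of lam "1 / \<tau>" c d, folded J_def, unfolded \<sigma>_eq]
    have ev: "{c. mat_eigenvalue (complex_mat J) c} =
          {complex_of_real \<sigma>, complex_of_real (- lam), 0, complex_of_real (- 1 / \<tau>)}"
      using spec(2) by simp
    moreover have "exponentially_unstable F p"
      unfolding exponentially_unstable_def J
      using diff that(1) ev \<sigma> by (auto simp: equilibria_def intro!: exI[of _ "complex_of_real \<sigma>"])
    ultimately show ?thesis
      using diff \<sigma> spec(1) by (simp add: J spectrum_mset_def)
  qed
  then show ?thesis
    using equilibria one_dimensional_equilibria[OF assms(2,4,5)] by (simp add: Let_def)
qed

end
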